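(* Let $\phi : [0,\infty) \to [0,\infty)$ be a function such that $\phi(x)/x \to 0$ as $x \to \infty$. Then there exists an entire function $f$, transcendental over $\mathbf{C}[z]$, such that $f(\alpha) \in \mathbf{Q}[\alpha]$ for all $\alpha \in \overline{\mathbf{Q}}$, and such that for every integer $D \geq 1$ there are infinitely many real numbers $N \geq 0$ satisfying $$\mathrm{card}\big(\Sigma_{D,N}(f,1)\big) \geq \tfrac{1}{2}\, e^{D(D+1)\phi(N)}.$$
   Context: $\overline{\mathbf{Q}}$ denotes the algebraic closure of $\mathbf{Q}$ in $\mathbf{C}$. For an algebraic number $\alpha$, $d(\alpha)$ denotes its degree over $\mathbf{Q}$, $M(\alpha)$ its Mahler measure (the Mahler measure of its minimal polynomial over $\mathbf{Z}$), and $h(\alpha) = \frac{1}{d(\alpha)} \log M(\alpha)$ its absolute logarithmic height. For $\rho>0$, $D(0,\rho)$ is the open disc $\{z \in \mathbf{C} : |z|<\rho\}$, with $D(0,\infty)=\mathbf{C}$, and $\overline{D(0,\rho)}$, for $\rho$ finite, is the closed disc. For $R \in \mathbf{R} \cup \{\infty\}$ and $r \in \mathbf{R}$ with $R > r > 0$, a function $f$ analytic (holomorphic) on $D(0,R)$, an integer $D \geq 1$ and a real number $N \geq 0$, $\Sigma_{D,N}(f,r)$ denotes the set of $\alpha \in \overline{\mathbf{Q}} \cap \overline{D(0,r)}$ such that $$f(\alpha) \in \overline{\mathbf{Q}}, \quad [\mathbf{Q}(\alpha, f(\alpha)) : \mathbf{Q}] \leq D, \quad h(\alpha) \leq N, \quad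 h(f(\alpha)) \leq N.$$ Here, $f$ being entire, one takes $R = \infty$ and $r = 1$. A function $f$ is transcendental over $\mathbf{C}[z]$ if there is no nonzero polynomial $P \in \mathbf{C}[X,Y]$ such that $P(z,f(z))$ is identically zero. *)

theory Defs
  imports
    "HOL-Analysis.Analysis"
    "HOL-Computational_Algebra.Computational_Algebra"
    "Berlekamp_Zassenhaus.Mahler_Measure"
begin

text \<open>
  An irreducible element of \<open>int poly\<close> of positive degree is automatically primitive, and no
  nonzero constant has a root; so for algebraic \<open>\<alpha>\<close> the following description has exactly one
  solution, the minimal polynomial of \<open>\<alpha>\<close> over the integers.
\<close>

definition int_minpoly :: "complex \<Rightarrow> int poly" where
  "int_minpoly \<alpha> = (THE p. irreducible p \<and> lead_coeff p > 0 \<and> poly (map_poly of_int p) \<alpha> = 0)"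

definition alg_degree :: "complex \<Rightarrow> nat" where
  "alg_degree \<alpha> = degree (int_minpoly \<alpha>)"

definition alg_mahler :: "complex \<Rightarrow> real" where
  "alg_mahler \<alpha> = mahler_measure (int_minpoly \<alpha>)"

definition abs_log_height :: "complex \<Rightarrow> real" where
  "abs_log_height \<alpha> = 1 / real (alg_degree \<alpha>) * ln (alg_mahler \<alpha>)"

definition complex_subfield :: "complex set \<Rightarrow> bool" where
  "complex_subfield K \<longleftrightarrow> 0 \<in> K \<and> 1 \<in> K \<and>
     (\<forall>x\<in>K. \<forall>y\<in>K. x + y \<in> K \<and> x - y \<in> K \<and> x * y \<in> K) \<and> (\<forall>x\<in>K. inverse x \<in> K)"

definition adjoin_field :: "complex set \<Rightarrow> complex set" where
  "adjoin_field S = complex_subfield hull S"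

definition adjoin_ring :: "complex \<Rightarrow> complex set" where
  "adjoin_ring \<alpha> = {poly (map_poly of_rat p) \<alpha> | p :: rat poly. True}"

text \<open>
  The degree of \<open>K\<close> over the rationals. As \<open>dim\<close> is 0 for infinite-dimensional spaces, this is
  only meaningful for finite extensions; below it is applied to fields generated by two
  algebraic numbers.
\<close>

definition degree_over_Q :: "complex set \<Rightarrow> nat" where
  "degree_over_Q K = vector_space.dim (\<lambda>(q::rat) (z::complex). of_rat q * z) K"

lemma vector_space_rat_complex: "vector_space (\<lambda>(q::rat) (z::complex). of_rat q * z)"
  by unfold_locales (simp_all add: algebra_simps of_rat_add of_rat_mult)

definition Sigma_set :: "nat \<Rightarrow> real \<Rightarrow> (complex \<Rightarrow> complex) \<Rightarrow> real \<Rightarrow> complex set" where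
  "Sigma_set D N f r = {\<alpha> \<in> cball 0 r. algebraic \<alpha> \<and> algebraic (f \<alpha>) \<and>
     degree_over_Q (adjoin_field {\<alpha>, f \<alpha>}) \<le> D \<and>
     abs_log_height \<alpha> \<le> N \<and> abs_log_height (f \<alpha>) \<le> N}"

text \<open>
  A bivariate polynomial \<open>P(X, Y)\<close> is an element of \<open>complex poly poly\<close>: a polynomial in \<open>Y\<close> with
  coefficients in \<open>\<complex>[X]\<close>. Substituting the constant \<open>[:w:]\<close> for \<open>Y\<close> and then \<open>z\<close> for \<open>X\<close>
  yields \<open>P(z, w)\<close>.
\<close>

definition transcendental_fun :: "(complex \<Rightarrow> complex) \<Rightarrow> bool" where
  "transcendental_fun f \<longleftrightarrow>
     \<not> (\<exists>P :: complex poly poly. P \<noteq> 0 \<and> (\<forall>z. poly (poly P [:f z:]) z = 0))"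

end

theory Submission
  imports Defs "HOL-Complex_Analysis.Complex_Analysis" "Berlekamp_Zassenhaus.Factor_Bound"
begin

text \<open>
  The function is \<open>f = \<Sum>\<^sub>k c\<^sub>k Q\<^sub>k\<^sub>+\<^sub>1\<close> with tiny nonzero rational \<open>c\<^sub>k\<close>, where \<open>Q\<^sub>k\<^sub>+\<^sub>1\<close> is \<open>Q\<^sub>k\<close> times the
  \<open>k\<close>-th rational polynomial of an enumeration times \<open>\<Prod>\<^sub>a\<^sub>\<le>\<^sub>q (X - a / q)\<close> for a large \<open>q = q\<^sub>k\<close>. At any algebraic
  number all but finitely many terms vanish, so \<open>f \<alpha>\<close> lies in \<open>\<rat>[\<alpha>]\<close>. At the points \<open>a / q\<^sub>k\<close> the
  function agrees with its \<open>k\<close>-th partial sum \<open>F\<^sub>k\<close>, so both \<open>a / q\<^sub>k\<close> and \<open>f (a / q\<^sub>k)\<close> are rational of height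
  at most \<open>N = O (ln q\<^sub>k)\<close>, with a constant depending only on \<open>F\<^sub>k\<close>. As \<open>\<phi> N = o(N)\<close>, a suitable choice of
  \<open>q\<^sub>k\<close> makes \<open>exp (D (D + 1) \<phi> N) \<le> q\<^sub>k\<close> for all \<open>D \<le> k\<close>: rational points alone suffice for the count.

  If \<open>P (z, f z) = 0\<close> identically, then \<open>P (X, F\<^sub>k)\<close> vanishes at more points than its degree allows once
  \<open>q\<^sub>k \<ge> k (deg F\<^sub>k + 1)\<close> and \<open>k\<close> is large, so \<open>P\<close> has infinitely many roots \<open>F\<^sub>k\<close> in \<open>\<complex>[X]\<close> and is zero.
\<close>

hide_const (open) Module.smult up_ring.monom up_ring.coeff

section \<open>Minimal polynomials and simple extensions\<close>

abbreviation rpoly :: "rat poly \<Rightarrow> complex \<Rightarrow> complex" where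
  "rpoly p z \<equiv> poly (map_poly of_rat p) z"

interpretation of_rat_poly_hom: map_poly_inj_idom_hom "of_rat :: rat \<Rightarrow> complex" ..

lemma rpoly_simps:
  "rpoly (p + q) z = rpoly p z + rpoly q z"
  "rpoly (p - q) z = rpoly p z - rpoly q z"
  "rpoly (p * q) z = rpoly p z * rpoly q z"
  "rpoly (smult c p) z = of_rat c * rpoly p z"
  "rpoly 0 z = 0" "rpoly 1 z = 1"
  "rpoly (monom c n) z = of_rat c * z ^ n"
  by (simp_all add: of_rat_poly_hom.hom_add of_rat_poly_hom.hom_minus of_rat_poly_hom.hom_mult hom_distribs
      map_poly_monom poly_monom)

lemma rpoly_of_rat: "rpoly p (of_rat x) = of_rat (poly p x)"
  by simp

lemma rpoly_of_int_poly: "rpoly (of_int_poly p) z = poly (of_int_poly p) z"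
  by (simp add: map_poly_map_poly o_def)

lemma adjoin_ring_iff: "x \<in> adjoin_ring \<alpha> \<longleftrightarrow> (\<exists>p. x = rpoly p \<alpha>)"
  by (auto simp: adjoin_ring_def)

text \<open>
  One of the imported theories hides \<open>Rings.coprime\<close>: unqualified \<open>coprime\<close> denotes another constant.
\<close>

lemma coprime_int_poly_bezout_rat:
  assumes "Rings.coprime p (q :: int poly)"
  obtains u v :: "rat poly" where "u * of_int_poly p + v * of_int_poly q = 1"
proof -
  have "gcd (of_int_poly p :: rat poly) (of_int_poly q) = 1"
    using assms by (subst gcd_rat_to_gcd_int) simp
  then show thesis
    using bezout_coefficients_fst_snd[of "of_int_poly p :: rat poly" "of_int_poly q"] that by metis
qed

text \<open>Otherwise \<open>p\<close> and \<open>q\<close> are coprime, and a Bezout identity over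
  the rationals, evaluated at the common root \<alpha>, gives 0 = 1.\<close>

lemma irreducible_int_poly_dvd_of_root:
  fixes p q :: "int poly" and \<alpha> :: complex
  assumes "irreducible p" "poly (of_int_poly p) \<alpha> = 0" "poly (of_int_poly q) \<alpha> = 0"
  shows "p dvd q"
proof (rule ccontr)
  assume "\<not> p dvd q"
  then have "Rings.coprime p q"
    by (rule prime_elem_imp_coprime[OF irreducible_imp_prime_poly[OF assms(1)]])
  then obtain u v :: "rat poly" where uv: "u * of_int_poly p + v * of_int_poly q = 1"
    by (rule coprime_int_poly_bezout_rat)
  have "rpoly (u * of_int_poly p + v * of_int_poly q) \<alpha> = 0"
    using assms by (simp only: rpoly_simps rpoly_of_int_poly) simp
  then show False
    by (simp only: uv rpoly_simps) simp
qed

text \<open>Two candidates share the root \<alpha>, hence divide each other; the sign of the leading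
  coefficient removes the remaining unit.\<close>

lemma int_minpoly_eqI:
  assumes "irreducible p" "lead_coeff p > 0" "poly (of_int_poly p) \<alpha> = 0"
  shows "int_minpoly \<alpha> = p"
  unfolding int_minpoly_def
proof (rule the_equality)
  fix q :: "int poly"
  assume q: "irreducible q \<and> lead_coeff q > 0 \<and> poly (map_poly of_int q) \<alpha> = 0"
  have dvd: "p dvd q" "q dvd p"
    using q assms irreducible_int_poly_dvd_of_root by blast+
  then have "normalize p = normalize q"
    by (rule normalization_semidom_class.associatedI)
  moreover have "normalize p = p" "normalize q = q"
    using q assms by (simp_all add: normalize_poly_def unit_factor_poly_def one_pCons[symmetric])
  ultimately show "q = p"
    by simp
qed (use assms in auto)

text \<open>A root of a nonzero integer polynomial is a root of one of its irreducible factors. This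
  discharges the existence part hidden in the \<open>THE\<close> of
  \<open>int_minpoly\<close>.\<close>

lemma int_minpoly:
  assumes "algebraic \<alpha>"
  shows "irreducible (int_minpoly \<alpha>)" "poly (of_int_poly (int_minpoly \<alpha>)) \<alpha> = 0"
proof -
  obtain p where p: "p \<noteq> 0" "poly (of_int_poly p) \<alpha> = 0"
    using assms by (rule algebraicE')
  have "p dvd prod_mset (prime_factorization p)"
    using prod_mset_prime_factorization_weak[OF p(1)] by (metis dvd_normalize_iff dvd_refl)
  then obtain r where r: "prod_mset (prime_factorization p) = p * r"
    by (elim dvdE)
  have "poly (of_int_poly (prod_mset (prime_factorization p))) \<alpha> = 0"
    using p by (simp add: r hom_distribs)
  moreover have "\<exists>q \<in># A. poly (of_int_poly q) \<alpha> = 0"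
    if "poly (of_int_poly (prod_mset A)) \<alpha> = 0" for A
    using that by (induction A) (auto simp: hom_distribs)
  ultimately obtain q where q: "q \<in># prime_factorization p" "poly (of_int_poly q) \<alpha> = 0"
    by blast
  then have irr: "irreducible q"
    by (auto simp: in_prime_factors_iff)
  then have "q \<noteq> 0"
    by auto
  \<comment> \<open>Passing to the associate with positive leading coefficient changes neither
    irreducibility nor the roots.\<close>
  define q' where "q' = (if lead_coeff q > 0 then q else - q)"
  have "lead_coeff q \<noteq> 0"
    using \<open>q \<noteq> 0\<close> by simp
  then have q': "irreducible q'" "lead_coeff q' > 0" "poly (of_int_poly q') \<alpha> = 0"
    using irr q(2) by (auto simp: q'_def of_int_poly_hom.hom_uminus simp del: leading_coeff_0_iff)
  show "irreducible (int_minpoly \<alpha>)" "poly (of_int_poly (int_minpoly \<alpha>)) \<alpha> = 0"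
    unfolding int_minpoly_eqI[OF q'] by (fact q')+
qed

lemma rat_poly_clear_denominators:
  fixes p :: "rat poly"
  obtains d :: int and q :: "int poly" where "d > 0" "of_int_poly q = smult (of_int d) p"
proof -
  obtain d q where dq: "rat_to_int_poly p = (d, q)"
    by force
  then show thesis
    using rat_to_int_poly(2)[OF dq] by (intro that[of d q]) (simp_all add: rat_to_int_poly(1)[OF dq])
qed

lemma alg_degree_le:
  assumes "algebraic \<alpha>" "p \<noteq> 0" "rpoly p \<alpha> = 0"
  shows "alg_degree \<alpha> \<le> degree p"
proof -
  obtain d q where dq: "d > 0" "of_int_poly q = smult (of_int d :: rat) p"
    by (rule rat_poly_clear_denominators)
  have "poly (of_int_poly q) \<alpha> = rpoly (smult (of_int d :: rat) p) \<alpha>"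
    by (simp flip: dq(2) add: rpoly_of_int_poly)
  also have "\<dots> = 0"
    using assms by (simp only: rpoly_simps) simp
  finally have "int_minpoly \<alpha> dvd q"
    using int_minpoly[OF assms(1)] irreducible_int_poly_dvd_of_root by blast
  moreover have "degree (of_int_poly q :: rat poly) = degree p" "q \<noteq> 0"
    using dq assms(2) by auto
  ultimately show ?thesis
    using dvd_imp_degree_le[of "int_minpoly \<alpha>" q] by (simp add: alg_degree_def)
qed

lemma alg_degree_pos:
  assumes "algebraic \<alpha>"
  shows "alg_degree \<alpha> > 0"
proof (rule ccontr)
  assume "\<not> alg_degree \<alpha> > 0"
  then obtain c where c: "int_minpoly \<alpha> = [:c:]"
    by (auto simp: alg_degree_def elim: degree_eq_zeroE)
  moreover have "c \<noteq> 0"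
    using int_minpoly(1)[OF assms] c by auto
  ultimately show False
    using int_minpoly(2)[OF assms] by simp
qed

text \<open>If \<open>x\<close> is nonzero, the minimal polynomial does not divide a polynomial
  representing a multiple of \<open>x\<close>, so the two are coprime; the Bezout cofactor evaluated
  at \<alpha> is the inverse up to the cleared denominator \<open>d\<close>.\<close>

lemma inverse_adjoin_ring:
  assumes "algebraic \<alpha>" "x \<in> adjoin_ring \<alpha>"
  shows "inverse x \<in> adjoin_ring \<alpha>"
proof (cases "x = 0")
  case False
  obtain p where p: "x = rpoly p \<alpha>"
    using assms(2) by (auto simp: adjoin_ring_iff)
  obtain d q where dq: "d > 0" "of_int_poly q = smult (of_int d :: rat) p"
    by (rule rat_poly_clear_denominators)
  have q: "poly (of_int_poly q) \<alpha> = rpoly (smult (of_int d :: rat) p) \<alpha>"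
    by (simp flip: dq(2) add: rpoly_of_int_poly)
  then have qx: "poly (of_int_poly q) \<alpha> = of_int d * x"
    by (simp only: rpoly_simps p) simp
  then have "poly (of_int_poly q) \<alpha> \<noteq> 0"
    using False dq by simp
  then have "\<not> int_minpoly \<alpha> dvd q"
    using int_minpoly[OF assms(1)] by (auto elim!: dvdE simp: hom_distribs)
  then have "Rings.coprime (int_minpoly \<alpha>) q"
    by (rule prime_elem_imp_coprime[OF irreducible_imp_prime_poly[OF int_minpoly(1)[OF assms(1)]]])
  then obtain u v :: "rat poly" where "u * of_int_poly (int_minpoly \<alpha>) + v * of_int_poly q = 1"
    by (rule coprime_int_poly_bezout_rat)
  then have "rpoly (u * of_int_poly (int_minpoly \<alpha>) + v * of_int_poly q) \<alpha> = rpoly 1 \<alpha>"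
    by simp
  then have "rpoly v \<alpha> * (of_int d * x) = 1"
    using int_minpoly[OF assms(1)] by (simp only: rpoly_simps rpoly_of_int_poly qx) simp
  then have "inverse x = rpoly (smult (of_int d) v) \<alpha>"
    using False by (simp only: rpoly_simps) (simp add: field_simps)
  then show ?thesis
    by (auto simp: adjoin_ring_iff)
qed (use assms in auto)

lemma complex_subfield_adjoin_ring:
  assumes "algebraic \<alpha>"
  shows "complex_subfield (adjoin_ring \<alpha>)"
proof -
  have "0 \<in> adjoin_ring \<alpha>" "1 \<in> adjoin_ring \<alpha>"
    using rpoly_simps(5,6) by (metis adjoin_ring_iff)+
  moreover have "x + y \<in> adjoin_ring \<alpha>" "x - y \<in> adjoin_ring \<alpha>" "x * y \<in> adjoin_ring \<alpha>"
    if "x \<in> adjoin_ring \<alpha>" "y \<in> adjoin_ring \<alpha>" for x y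
    using that by (auto simp: adjoin_ring_iff simp flip: rpoly_simps)
  ultimately show ?thesis
    using inverse_adjoin_ring[OF assms] by (auto simp: complex_subfield_def)
qed

section \<open>The power basis of a simple extension\<close>

interpretation ratc: vector_space "\<lambda>(q::rat) (z::complex). of_rat q * z"
  by (rule vector_space_rat_complex)

lemma rpoly_eq_sum: "degree p < n \<Longrightarrow> rpoly p z = (\<Sum>i<n. of_rat (coeff p i) * z ^ i)"
  unfolding poly_altdef of_rat_poly_hom.degree_map_poly_hom
  by (intro sum.mono_neutral_cong_left) (auto simp: coeff_eq_0)

text \<open>Reduction modulo the minimal polynomial leaves a remainder of degree below
  \<open>alg_degree \<alpha>\<close>.\<close>

lemma adjoin_ring_subset_span:
  assumes "algebraic \<alpha>"
  shows "adjoin_ring \<alpha> \<subseteq> ratc.span ((\<lambda>i. \<alpha> ^ i) ` {..<alg_degree \<alpha>})"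
proof
  fix x assume "x \<in> adjoin_ring \<alpha>"
  then obtain p where p: "x = rpoly p \<alpha>"
    by (auto simp: adjoin_ring_iff)
  define m :: "rat poly" where "m = of_int_poly (int_minpoly \<alpha>)"
  have m: "m \<noteq> 0" "degree m = alg_degree \<alpha>" "rpoly m \<alpha> = 0"
    using int_minpoly[OF assms] by (auto simp: m_def alg_degree_def rpoly_of_int_poly)
  have "rpoly p \<alpha> = rpoly (p div m * m + p mod m) \<alpha>"
    by simp
  also have "\<dots> = rpoly (p mod m) \<alpha>"
    using m by (simp only: rpoly_simps) simp
  also have "\<dots> = (\<Sum>i<alg_degree \<alpha>. of_rat (coeff (p mod m) i) * \<alpha> ^ i)"
    using degree_mod_less'[of m p] m alg_degree_pos[OF assms]
    by (intro rpoly_eq_sum) (cases "p mod m = 0"; auto)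
  also have "\<dots> \<in> ratc.span ((\<lambda>i. \<alpha> ^ i) ` {..<alg_degree \<alpha>})"
    by (intro ratc.span_sum ratc.span_scale ratc.span_base) auto
  finally show "x \<in> ratc.span ((\<lambda>i. \<alpha> ^ i) ` {..<alg_degree \<alpha>})"
    by (simp add: p)
qed

text \<open>A linear relation among these powers is a rational polynomial of too small degree
  vanishing at \<alpha>, hence zero. Injectivity is stated separately because independence concerns
  the image set, in which equal powers would collapse.\<close>

lemma independent_powers:
  assumes "algebraic \<alpha>"
  shows "inj_on (\<lambda>i. \<alpha> ^ i) {..<alg_degree \<alpha>}"
    and "ratc.independent ((\<lambda>i. \<alpha> ^ i) ` {..<alg_degree \<alpha>})"
proof -
  let ?d = "alg_degree \<alpha>"
  have zero: "c i = 0" if "(\<Sum>i<?d. of_rat (c i) * \<alpha> ^ i) = 0" "i < ?d" for c :: "nat \<Rightarrow> rat" and i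
  proof -
    define p where "p = (\<Sum>i<?d. monom (c i) i)"
    have co: "coeff p i = (if i < ?d then c i else 0)" for i
      by (simp add: p_def coeff_sum if_distrib if_distribR cong: if_cong)
    have deg: "degree p < ?d"
      using alg_degree_pos[OF assms] co by (intro degree_lessI) auto
    then have "rpoly p \<alpha> = (\<Sum>i<?d. of_rat (coeff p i) * \<alpha> ^ i)"
      by (rule rpoly_eq_sum)
    also have "\<dots> = 0"
      using that(1) by (simp add: co)
    finally have "p = 0"
      using alg_degree_le[OF assms] deg by force
    then show ?thesis
      using co[of i] that(2) by simp
  qed
  show inj: "inj_on (\<lambda>i. \<alpha> ^ i) {..<?d}"
  proof (rule inj_onI, rule ccontr)
    fix i j assume ij: "i \<in> {..<?d}" "j \<in> {..<?d}" "\<alpha> ^ i = \<alpha> ^ j" "i \<noteq> j"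
    \<comment> \<open>These are the coefficients of the relation
      \<open>\<alpha> ^ i - \<alpha> ^ j = 0\<close>.\<close>
    define c :: "nat \<Rightarrow> rat" where "c = (\<lambda>k. (if k = i then 1 else 0) - (if k = j then 1 else 0))"
    have "(\<Sum>k<?d. of_rat (c k) * \<alpha> ^ k)
      = (\<Sum>k<?d. (if k = i then \<alpha> ^ k else 0) - (if k = j then \<alpha> ^ k else 0))"
      by (intro sum.cong) (auto simp: c_def)
    also have "\<dots> = 0"
      using ij by (simp add: sum_subtractf)
    finally have "c i = 0"
      using zero ij by blast
    then show False
      using ij by (simp add: c_def)
  qed
  show "ratc.independent ((\<lambda>i. \<alpha> ^ i) ` {..<?d})"
  proof (rule ratc.independent_if_scalars_zero)
    fix f x assume *: "(\<Sum>x\<in>(\<lambda>i. \<alpha> ^ i) ` {..<?d}. of_rat (f x) * x) = 0"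
      and x: "x \<in> (\<lambda>i. \<alpha> ^ i) ` {..<?d}"
    from x obtain i where i: "i < ?d" "x = \<alpha> ^ i"
      by blast
    have "(\<Sum>i<?d. of_rat (f (\<alpha> ^ i)) * \<alpha> ^ i) = 0"
      using * by (simp only: sum.reindex[OF inj] o_def)
    then show "f x = 0"
      using zero[of "\<lambda>i. f (\<alpha> ^ i)" i] i by (simp only:)
  qed auto
qed

text \<open>The generated field contains the independent powers of \<alpha> and lies in their span,
  so its dimension is finite and \<open>dim\<close> does not take its default value 0. This turns
  the degree bound in \<open>Sigma_set\<close> into one on \<alpha> alone.\<close>

lemma alg_degree_le_degree_over_Q:
  assumes "algebraic \<alpha>" "\<beta> \<in> adjoin_ring \<alpha>"
  shows "alg_degree \<alpha> \<le> degree_over_Q (adjoin_field {\<alpha>, \<beta>})"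
proof -
  let ?K = "adjoin_field {\<alpha>, \<beta>}" and ?B = "(\<lambda>i. \<alpha> ^ i) ` {..<alg_degree \<alpha>}"
  have "\<alpha> \<in> adjoin_ring \<alpha>"
    unfolding adjoin_ring_iff using rpoly_simps(7)[of 1 1 \<alpha>] by (intro exI[of _ "monom 1 1"]) simp
  then have "?K \<subseteq> adjoin_ring \<alpha>"
    unfolding adjoin_field_def using assms complex_subfield_adjoin_ring by (intro hull_minimal) auto
  then have K: "?K \<subseteq> ratc.span ?B"
    using adjoin_ring_subset_span[OF assms(1)] by blast
  have "\<alpha> ^ i \<in> L" if "complex_subfield L" "\<alpha> \<in> L" for L i
    using that by (induction i) (auto simp: complex_subfield_def)
  then have B: "?B \<subseteq> ?K"
    by (auto simp: adjoin_field_def hull_def)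
  obtain C where C: "C \<subseteq> ?K" "ratc.independent C" "?K \<subseteq> ratc.span C" "card C = ratc.dim ?K"
    by (rule ratc.basis_exists)
  have "finite C"
    using ratc.independent_span_bound[of ?B C] C K by blast
  then have "card ?B \<le> card C"
    using ratc.independent_span_bound[of C ?B] C B independent_powers[OF assms(1)] by blast
  then show ?thesis
    using C(4) independent_powers(1)[OF assms(1)] by (simp add: degree_over_Q_def card_image)
qed

lemma degree_over_Q_rat: "degree_over_Q (adjoin_field {of_rat x, of_rat y}) \<le> 1"
proof -
  have "adjoin_field {of_rat x, of_rat y} \<subseteq> range of_rat"
    unfolding adjoin_field_def
    by (rule hull_minimal)
       (auto simp: complex_subfield_def simp flip: of_rat_add of_rat_diff of_rat_mult of_rat_inverse
             intro: image_eqI[of 0 _ 0] image_eqI[of 1 _ 1])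
  also have "\<dots> \<subseteq> ratc.span {1}"
    using ratc.span_scale[OF ratc.span_base[of 1 "{1}"]] by auto
  finally show ?thesis
    using ratc.dim_le_card[of "adjoin_field {of_rat x, of_rat y}" "{1}"] by (simp add: degree_over_Q_def)
qed

section \<open>Northcott finiteness and heights of rational numbers\<close>

lemma finite_int_polys_bounded: "finite {p :: int poly. degree p \<le> D \<and> (\<forall>i. \<bar>coeff p i\<bar> \<le> C)}"
proof (rule finite_subset)
  show "{p :: int poly. degree p \<le> D \<and> (\<forall>i. \<bar>coeff p i\<bar> \<le> C)}
    \<subseteq> Poly ` {xs. set xs \<subseteq> {- C..C} \<and> length xs \<le> Suc D}"
  proof
    fix p :: "int poly" assume p: "p \<in> {p. degree p \<le> D \<and> (\<forall>i. \<bar>coeff p i\<bar> \<le> C)}"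
    have "length (coeffs p) \<le> Suc D"
      using p by (cases "p = 0") (auto simp: length_coeffs)
    moreover have "set (coeffs p) \<subseteq> {- C..C}"
      using p by (auto simp: coeffs_def abs_le_iff) (use minus_le_iff in blast)+
    ultimately show "p \<in> Poly ` {xs. set xs \<subseteq> {- C..C} \<and> length xs \<le> Suc D}"
      by (intro image_eqI[of _ _ "coeffs p"]) auto
  qed
qed (intro finite_imageI finite_lists_length_le, simp)

text \<open>The Mahler measure is the absolute leading coefficient times that of the monic
  polynomial, which is at least 1.\<close>

lemma mahler_measure_ge_lead_coeff: "\<bar>lead_coeff p\<bar> \<le> mahler_measure p"
  unfolding mahler_measure_def mahler_measure_poly_via_monic
  using mult_left_mono[OF mahler_measure_monic_ge_1[of "of_int_poly p"], of "\<bar>real_of_int (lead_coeff p)\<bar>"]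
  by simp

text \<open>Degree and height bound the Mahler measure of the minimal polynomial, hence its
  coefficients. Only finitely many integer polynomials remain, each with finitely many
  roots.\<close>

lemma northcott: "finite {\<alpha>. algebraic \<alpha> \<and> alg_degree \<alpha> \<le> D \<and> abs_log_height \<alpha> \<le> N}"
proof -
  \<comment> \<open>As \<open>N\<close> may be negative, its absolute value is taken, so that the
    bound is monotone in the degree.\<close>
  define M where "M = exp (real D * \<bar>N\<bar>)"
  \<comment> \<open>Mignotte's coefficient estimate has two summands, each at most
    \<open>2 ^ D * M\<close>.\<close>
  define C where "C = \<lfloor>2 * 2 ^ D * M\<rfloor>"
  define A where "A = {p :: int poly. degree p \<le> D \<and> (\<forall>i. \<bar>coeff p i\<bar> \<le> C)}"
  have "\<alpha> \<in> (\<Union>p\<in>A - {0}. {z. poly (of_int_poly p) z = 0})"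
    if \<alpha>: "algebraic \<alpha>" "alg_degree \<alpha> \<le> D" "abs_log_height \<alpha> \<le> N" for \<alpha>
  proof -
    define m where "m = int_minpoly \<alpha>"
    have m: "m \<noteq> 0" "poly (of_int_poly m) \<alpha> = 0" "degree m = alg_degree \<alpha>"
      using int_minpoly[OF \<alpha>(1)] by (auto simp: m_def alg_degree_def)
    have pos: "mahler_measure m \<ge> 1"
      using mahler_measure_poly_ge_1 m by blast
    have "ln (mahler_measure m) = real (alg_degree \<alpha>) * abs_log_height \<alpha>"
      using alg_degree_pos[OF \<alpha>(1)] by (simp add: abs_log_height_def alg_mahler_def m_def)
    also have "\<dots> \<le> real (alg_degree \<alpha>) * \<bar>N\<bar>"
      using \<alpha>(3) by (intro mult_left_mono) auto
    also have "\<dots> \<le> real D * \<bar>N\<bar>"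
      using \<alpha>(2) by (intro mult_right_mono) auto
    finally have M: "mahler_measure m \<le> M"
      using pos exp_le_cancel_iff[of "ln (mahler_measure m)"] by (simp add: M_def)
    have binom: "real (degree m - 1 choose i) \<le> 2 ^ D" for i
    proof -
      have "degree m - 1 choose i \<le> 2 ^ (degree m - 1)"
        by (rule binomial_le_pow2)
      also have "\<dots> \<le> 2 ^ D"
        using m \<alpha> by (intro power_increasing) auto
      finally have "real (degree m - 1 choose i) \<le> real (2 ^ D)"
        by (rule of_nat_mono)
      then show ?thesis
        by simp
    qed
    have "\<bar>coeff m i\<bar> \<le> C" for i
    proof -
      have "\<bar>coeff m i\<bar> \<le> (degree m - 1 choose i) * mahler_measure m +
          (min i 1 * (degree m - 1 choose (i - 1)) * \<bar>lead_coeff m\<bar>)"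
        by (rule mignotte_coeff_helper)
      also have "\<dots> = real (degree m - 1 choose i) * mahler_measure m +
          real (min i 1) * real (degree m - 1 choose (i - 1)) * \<bar>real_of_int (lead_coeff m)\<bar>"
        by simp
      also have "\<dots> \<le> 2 ^ D * M + 1 * 2 ^ D * M"
      proof (intro add_mono mult_mono)
        show "\<bar>real_of_int (lead_coeff m)\<bar> \<le> M"
          using M mahler_measure_ge_lead_coeff[of m] by linarith
        show "real (min i 1) \<le> 1"
          by simp
      qed (use binom M pos in auto)
      finally show ?thesis
        by (simp add: C_def le_floor_iff mult_ac)
    qed
    then have "m \<in> A - {0}"
      using m \<alpha> by (simp add: A_def)
    then show ?thesis
      using m by blast
  qed
  then have "{\<alpha>. algebraic \<alpha> \<and> alg_degree \<alpha> \<le> D \<and> abs_log_height \<alpha> \<le> N}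
      \<subseteq> (\<Union>p\<in>A - {0}. {z. poly (of_int_poly p) z = 0})"
    by blast
  moreover have "finite (\<Union>p\<in>A - {0}. {z :: complex. poly (of_int_poly p) z = 0})"
    using finite_int_polys_bounded unfolding A_def by (intro finite_UN_I) (auto intro!: poly_roots_finite)
  ultimately show ?thesis
    by (rule finite_subset)
qed

text \<open>
  Needed for a lower bound on the cardinality, because \<open>card\<close> is 0 on infinite sets.
\<close>

lemma finite_Sigma_set:
  assumes "\<And>\<alpha>. algebraic \<alpha> \<Longrightarrow> f \<alpha> \<in> adjoin_ring \<alpha>"
  shows "finite (Sigma_set D N f r)"
proof (rule finite_subset)
  show "Sigma_set D N f r \<subseteq> {\<alpha>. algebraic \<alpha> \<and> alg_degree \<alpha> \<le> D \<and> abs_log_height \<alpha> \<le> N}"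
    using alg_degree_le_degree_over_Q assms by (force simp: Sigma_set_def)
qed (rule northcott)

text \<open>The minimal polynomial is \<open>b X - a\<close>: it is linear, and primitive by
  coprimality. Its Mahler measure is \<open>b * max 1 \<bar>a / b\<bar>\<close>.\<close>

lemma abs_log_height_coprime:
  assumes "Rings.coprime a b" "b > 0"
  shows "abs_log_height (of_int a / of_int b) = ln (max \<bar>a\<bar> b)"
proof -
  define p where "p = [:- a, b:]"
  have "content p = 1"
    using assms by (simp add: p_def content_def coprime_iff_gcd_eq_1)
  moreover have "irreducible\<^sub>d p"
    using assms by (intro linear_irreducible\<^sub>d) (simp add: p_def)
  ultimately have "irreducible p"
    using irreducible_primitive_connect[of p] by simp
  then have min: "int_minpoly (of_int a / of_int b) = p"
    using assms by (intro int_minpoly_eqI) (auto simp: p_def)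
  have "of_int_poly p = smult (complex_of_int b) (\<Prod>x\<leftarrow>[of_int a / of_int b]. [:- x, 1:])"
    using assms by (simp add: p_def)
  then have "mahler_measure p = \<bar>of_int b\<bar> * max 1 (cmod (of_int a / of_int b))"
    by (simp only: mahler_measure_def mahler_measure_poly_explicit) simp
  also have "\<dots> = max (real_of_int b) \<bar>real_of_int a\<bar>"
    using assms by (simp add: norm_divide max_mult_distrib_left)
  also have "\<dots> = real_of_int (max \<bar>a\<bar> b)"
    by (simp add: max.commute)
  finally show ?thesis
    using assms by (simp add: abs_log_height_def alg_degree_def alg_mahler_def min p_def)
qed

text \<open>Cancelling a common factor can only shrink numerator and denominator, so the bound may
  be read off an unreduced fraction.\<close>

lemma abs_log_height_fraction_le:
  assumes "b \<noteq> 0" "\<bar>real_of_int a\<bar> \<le> H" "\<bar>real_of_int b\<bar> \<le> H"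
  shows "abs_log_height (of_int a / of_int b) \<le> ln H"
proof -
  define r :: rat where "r = of_int a / of_int b"
  obtain n m where nm: "quotient_of r = (n, m)"
    by force
  have m: "m > 0" "Rings.coprime n m"
    using nm quotient_of_denom_pos quotient_of_coprime by blast+
  have "of_int a / of_int b = (of_int n / of_int m :: rat)"
    using quotient_of_div[OF nm] by (simp add: r_def)
  then have eq: "rat_of_int (a * m) = rat_of_int (n * b)"
    using m assms(1) by (simp add: field_simps)
  then have "a * m = n * b"
    by (simp only: of_int_eq_iff)
  then have nm_eq: "n * b = m * a"
    by (metis mult.commute)
  then have "m dvd n * b"
    by (rule dvdI)
  then have "m dvd b"
    using m(2) by (simp add: algebraic_semidom_class.coprime_commute
      semiring_gcd_class.coprime_dvd_mult_right_iff)
  then obtain k where "b = m * k"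
    by (rule dvdE)
  with nm_eq m(1) have k: "a = n * k" "b = m * k"
    by auto
  then have "k \<noteq> 0"
    using assms by auto
  then have "\<bar>n\<bar> * 1 \<le> \<bar>a\<bar>" "\<bar>m\<bar> * 1 \<le> \<bar>b\<bar>"
    unfolding k abs_mult by (intro mult_left_mono; simp)+
  then have le: "real_of_int (max \<bar>n\<bar> m) \<le> H"
    using assms by linarith
  have "of_int a / of_int b = (of_int n / of_int m :: complex)"
    using k \<open>k \<noteq> 0\<close> by simp
  then have "abs_log_height (of_int a / of_int b) = ln (max \<bar>n\<bar> m)"
    using abs_log_height_coprime m by simp
  also have "\<dots> \<le> ln H"
    using le m by (subst ln_le_cancel_iff) auto
  finally show ?thesis .
qed

text \<open>Clearing the denominators of \<open>F\<close> by \<open>d\<close> and of the argument by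
  \<open>q ^ degree F\<close> writes the value as an integer over \<open>d * q ^ degree F\<close>.
  It is essential that \<open>B\<close> depends on \<open>F\<close> only, as \<open>q\<close> is
  chosen after \<open>F\<close>.\<close>

lemma abs_log_height_rpoly_fraction_le:
  fixes F :: "rat poly"
  shows "\<exists>B::real. B \<ge> 1 \<and> (\<forall>a q :: nat. a \<le> q \<longrightarrow> q \<ge> 1 \<longrightarrow>
    abs_log_height (of_rat (poly F (of_nat a / of_nat q))) \<le> ln (B * real q ^ degree F))"
proof -
  define n where "n = degree F"
  obtain d G where dG: "d > 0" "of_int_poly G = smult (of_int d :: rat) F"
    by (rule rat_poly_clear_denominators)
  \<comment> \<open>The summand \<open>d\<close> covers the denominator, the sum of absolute
    coefficients the numerator.\<close>
  define B where "B = real_of_int d + (\<Sum>i\<le>n. \<bar>real_of_int (coeff G i)\<bar>)"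
  have B: "B \<ge> real_of_int d" "B \<ge> (\<Sum>i\<le>n. \<bar>real_of_int (coeff G i)\<bar>)"
    using dG(1) by (auto simp: B_def intro: sum_nonneg)
  show ?thesis
  proof (intro exI[of _ B] conjI allI impI)
    show "B \<ge> 1"
      using B(1) dG(1) by linarith
    fix a q :: nat assume aq: "a \<le> q" "q \<ge> 1"
    define A where "A = (\<Sum>i\<le>n. coeff G i * int a ^ i * int q ^ (n - i))"
    have "degree (of_int_poly G :: rat poly) = n"
      using dG by (simp add: n_def)
    then have deg: "degree G = n"
      by simp
    have "of_int d * poly F (of_nat a / of_nat q) = poly (of_int_poly G) (of_nat a / of_nat q)"
      by (simp add: dG(2))
    also have "\<dots> = (\<Sum>i\<le>n. of_int (coeff G i) * (of_nat a / of_nat q) ^ i)"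
      by (simp add: poly_altdef deg)
    also have "\<dots> * of_nat q ^ n = (\<Sum>i\<le>n. of_int (coeff G i * int a ^ i * int q ^ (n - i)))"
      unfolding sum_distrib_right
    proof (rule sum.cong)
      fix i assume "i \<in> {..n}"
      then have "(of_nat q :: rat) ^ n = of_nat q ^ i * of_nat q ^ (n - i)"
        by (simp flip: power_add)
      then show "of_int (coeff G i) * (of_nat a / of_nat q) ^ i * of_nat q ^ n
          = (of_int (coeff G i * int a ^ i * int q ^ (n - i)) :: rat)"
        using aq by (simp add: power_divide)
    qed simp
    also have "\<dots> = of_int A"
      by (simp add: A_def)
    finally have "poly F (of_nat a / of_nat q) = of_int A / of_int (d * int q ^ n)"
      using dG(1) aq by (simp add: field_simps)
    then have eq: "of_rat (poly F (of_nat a / of_nat q)) = (of_int A / of_int (d * int q ^ n) :: complex)"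
      by (simp only: of_rat_divide of_rat_of_int_eq)
    have "\<bar>real_of_int A\<bar> \<le> (\<Sum>i\<le>n. \<bar>real_of_int (coeff G i * int a ^ i * int q ^ (n - i))\<bar>)"
      unfolding A_def of_int_sum by (rule sum_abs)
    also have "\<dots> \<le> (\<Sum>i\<le>n. \<bar>real_of_int (coeff G i)\<bar> * real q ^ n)"
    proof (rule sum_mono)
      fix i assume i: "i \<in> {..n}"
      have "real a ^ i * real q ^ (n - i) \<le> real q ^ i * real q ^ (n - i)"
        using aq by (intro mult_right_mono power_mono) auto
      also have "\<dots> = real q ^ n"
        using i by (simp flip: power_add)
      finally have "\<bar>real_of_int (coeff G i)\<bar> * (real a ^ i * real q ^ (n - i))
          \<le> \<bar>real_of_int (coeff G i)\<bar> * real q ^ n"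
        by (rule mult_left_mono) simp
      then show "\<bar>real_of_int (coeff G i * int a ^ i * int q ^ (n - i))\<bar>
          \<le> \<bar>real_of_int (coeff G i)\<bar> * real q ^ n"
        by (simp add: abs_mult mult.assoc)
    qed
    also have "\<dots> \<le> B * real q ^ n"
      unfolding sum_distrib_right[symmetric] by (intro mult_right_mono B) simp
    finally have "\<bar>real_of_int A\<bar> \<le> B * real q ^ n" .
    moreover have "\<bar>real_of_int (d * int q ^ n)\<bar> \<le> B * real q ^ n"
      using B(1) dG(1) by (simp add: abs_mult mult_right_mono)
    moreover have "d * int q ^ n \<noteq> 0"
      using dG(1) aq by simp
    ultimately show "abs_log_height (of_rat (poly F (of_nat a / of_nat q))) \<le> ln (B * real q ^ degree F)"
      unfolding eq n_def by (intro abs_log_height_fraction_le)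
  qed
qed

section \<open>The construction\<close>

text \<open>The bound by \<open>k * (degree F + 1)\<close> serves transcendence, the one by
  \<open>degree F\<close> makes the degrees of the partial sums grow. \<open>N \<ge> real k\<close>
  makes the heights unbounded, and asking for all \<open>D \<le> k\<close> at once lets every fixed
  \<open>D\<close> be served by all large \<open>k\<close>.\<close>

definition admissible :: "(real \<Rightarrow> real) \<Rightarrow> nat \<Rightarrow> rat poly \<Rightarrow> nat \<Rightarrow> bool" where
  "admissible \<phi> k F q \<longleftrightarrow> q \<ge> 1 \<and> q \<ge> k * (degree F + 1) \<and> q \<ge> degree F \<and>
    (\<exists>N \<ge> real k.
      (\<forall>a\<le>q. abs_log_height (of_rat (of_nat a / of_nat q)) \<le> N \<and>
        abs_log_height (of_rat (poly F (of_nat a / of_nat q))) \<le> N) \<and>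
      (\<forall>D\<le>k. exp (real D * (real D + 1) * \<phi> N) \<le> real q))"

text \<open>The heights at the nodes are at most a linear function \<open>N q\<close> of
  \<open>ln q\<close>, and \<open>\<phi> (N q)\<close> is eventually below any fixed multiple of
  \<open>N q\<close>; hence its exponential stays below \<open>q\<close>.\<close>

lemma ex_admissible:
  assumes "\<And>x. x \<ge> 0 \<Longrightarrow> \<phi> x \<ge> 0" "((\<lambda>x. \<phi> x / x) \<longlongrightarrow> 0) at_top"
  shows "\<exists>q. admissible \<phi> k F q"
proof -
  define n where "n = real (degree F) + 1"
  have n: "n \<ge> 1"
    by (simp add: n_def)
  obtain B where B: "B \<ge> 1"
    and height: "\<And>a q :: nat. a \<le> q \<Longrightarrow> q \<ge> 1 \<Longrightarrow>
      abs_log_height (of_rat (poly F (of_nat a / of_nat q))) \<le> ln (B * real q ^ degree F)"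
    using abs_log_height_rpoly_fraction_le[of F] by blast
  \<comment> \<open>The factor \<open>n\<close> is \<open>degree F + 1\<close>, not
    \<open>degree F\<close>, so that \<open>N q\<close> also dominates \<open>ln q\<close>, the
    bound for the height of \<open>a / q\<close> itself, even for constant \<open>F\<close>.\<close>
  define N where "N q = ln B + n * ln (real q)" for q :: nat
  define K where "K = real k * (real k + 1) + 1"
  \<comment> \<open>Chosen so that \<open>K * \<epsilon> * N q = N q / (2 * n)\<close>, which is at
    most \<open>(ln B + ln q) / 2\<close> and hence at most \<open>ln q\<close> once
    \<open>q \<ge> B\<close>.\<close>
  define \<epsilon> where "\<epsilon> = 1 / (2 * n * K)"
  have K: "K > 0"
    by (simp add: K_def add_nonneg_pos)
  then have \<epsilon>: "\<epsilon> > 0"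
    using n by (simp add: \<epsilon>_def)
  have ln_top: "filterlim (\<lambda>q. ln (real q)) at_top sequentially"
    by (rule filterlim_compose[OF ln_at_top filterlim_real_sequentially])
  have N_ge: "\<forall>\<^sub>F q in sequentially. ln (real q) \<le> N q"
    using eventually_ge_at_top[of 1]
  proof eventually_elim
    case (elim q)
    have "1 * ln (real q) \<le> n * ln (real q)"
      using n elim by (intro mult_right_mono) auto
    then show ?case
      using ln_ge_zero[OF B] unfolding N_def by linarith
  qed
  have N_top: "filterlim N at_top sequentially"
    by (rule filterlim_at_top_mono[OF ln_top N_ge])
  have "\<forall>\<^sub>F x in at_top. \<phi> x / x < \<epsilon>"
    using order_tendstoD(2)[OF assms(2) \<epsilon>] .
  then have "\<forall>\<^sub>F q in sequentially. \<phi> (N q) / N q < \<epsilon>"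
    by (rule eventually_compose_filterlim[OF _ N_top])
  \<comment> \<open>The extra 1 keeps \<open>N q\<close> positive also for \<open>k = 0\<close>, so
    that the quotient bound on \<phi> can be multiplied out.\<close>
  moreover have "\<forall>\<^sub>F q in sequentially. N q \<ge> real k + 1"
    using N_top by (simp add: filterlim_at_top)
  moreover have "\<forall>\<^sub>F q in sequentially. ln (real q) \<ge> ln B"
    using ln_top by (simp add: filterlim_at_top)
  ultimately have "\<forall>\<^sub>F q in sequentially. q \<ge> 1 + (k + 1) * (degree F + 1) \<and> \<phi> (N q) / N q < \<epsilon> \<and>
      N q \<ge> real k + 1 \<and> ln (real q) \<ge> ln B"
    using eventually_ge_at_top[of "1 + (k + 1) * (degree F + 1)"] by eventually_elim auto
  then obtain q where q: "q \<ge> 1 + (k + 1) * (degree F + 1)" "\<phi> (N q) / N q < \<epsilon>"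
      "N q \<ge> real k + 1" "ln (real q) \<ge> ln B"
    using eventually_happens' sequentially_bot by blast
  have q1: "q \<ge> 1"
    using q(1) by simp
  have N_eq: "N q = ln (B * real q ^ (degree F + 1))"
    using B q1 by (simp add: N_def n_def ln_mult ln_realpow algebra_simps)
  have "\<phi> (N q) \<le> \<epsilon> * N q"
    using q by (simp add: field_simps)
  have growth: "exp (real D * (real D + 1) * \<phi> (N q)) \<le> real q" if "D \<le> k" for D
  proof -
    have "real D * (real D + 1) * \<phi> (N q) \<le> K * (\<epsilon> * N q)"
    proof (rule mult_mono)
      have "real D * (real D + 1) \<le> real k * (real k + 1)"
        using that by (intro mult_mono) auto
      then show "real D * (real D + 1) \<le> K"
        by (simp add: K_def)
    qed (use K assms(1)[of "N q"] q \<open>\<phi> (N q) \<le> \<epsilon> * N q\<close> in auto)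
    also have "\<dots> = N q / (2 * n)"
      using K n by (simp add: \<epsilon>_def field_simps)
    also have "\<dots> = ln B / (2 * n) + ln (real q) / 2"
      using n by (simp add: N_def field_simps)
    also have "\<dots> \<le> ln B / 2 + ln (real q) / 2"
      using n B by (intro add_right_mono divide_left_mono) auto
    also have "\<dots> \<le> ln (real q)"
      using q by simp
    finally show ?thesis
      using q1 by (simp add: ln_ge_iff)
  qed
  have "abs_log_height (of_rat (of_nat a / of_nat q)) \<le> N q" if "a \<le> q" for a
  proof -
    have "real q * 1 \<le> real q * (B * real q ^ degree F)"
      using B q1 mult_mono[of 1 B 1 "real q ^ degree F"] by (intro mult_left_mono) auto
    then have le: "real q \<le> B * real q ^ (degree F + 1)"
      by (simp add: mult_ac)
    have "abs_log_height (of_int (int a) / of_int (int q)) \<le> N q"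
      unfolding N_eq
    proof (rule abs_log_height_fraction_le)
      show "\<bar>real_of_int (int a)\<bar> \<le> B * real q ^ (degree F + 1)"
        using le that by linarith
      show "\<bar>real_of_int (int q)\<bar> \<le> B * real q ^ (degree F + 1)"
        using le by linarith
    qed (use q1 in simp)
    then show ?thesis
      by (simp add: of_rat_divide)
  qed
  moreover have "abs_log_height (of_rat (poly F (of_nat a / of_nat q))) \<le> N q" if "a \<le> q" for a
  proof -
    have "B * real q ^ degree F \<le> B * real q ^ (degree F + 1)"
      using B q1 by (intro mult_left_mono power_increasing) auto
    then have "ln (B * real q ^ degree F) \<le> N q"
      unfolding N_eq using B q1 by (subst ln_le_cancel_iff) auto
    then show ?thesis
      using height[OF that q1] by linarith
  qed
  ultimately show ?thesis
    unfolding admissible_def using q q1 growth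
    by (intro exI[of _ q] conjI exI[of _ "N q"]) auto
qed

text \<open>Induction along the Horner scheme: each step adds at most \<open>degree G\<close> or a
  fixed coefficient degree. The linear bound limits the number of zeros of
  \<open>P (z, G z)\<close>.\<close>

lemma degree_poly_const_le:
  fixes P :: "'a :: comm_ring_1 poly poly"
  shows "\<exists>M. \<forall>G. degree (poly P G) \<le> M * (degree G + 1)"
proof (induction P)
  case (pCons c P)
  then obtain M where M: "degree (poly P G) \<le> M * (degree G + 1)" for G
    by blast
  have "degree (poly (pCons c P) G) \<le> (degree c + M + 1) * (degree G + 1)" for G
  proof -
    have "degree (G * poly P G) \<le> degree G + M * (degree G + 1)"
      using degree_mult_le[of G "poly P G"] M[of G] by linarith
    then have "degree (poly (pCons c P) G) \<le> max (degree c) (degree G + M * (degree G + 1))"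
      using degree_add_le_max[of c "G * poly P G"] by (simp add: le_max_iff_disj) linarith
    also have "\<dots> \<le> (degree c + M + 1) * (degree G + 1)"
      by (simp add: algebra_simps)
    finally show ?thesis .
  qed
  then show ?case
    by blast
qed auto

lemma poly_poly_const: "poly (poly P [:poly G z:]) z = poly (poly P G) z"
  by (induction P) auto

section \<open>Nodes, enumeration of rational polynomials, small multiples\<close>

definition node_poly :: "nat \<Rightarrow> rat poly" where
  "node_poly q = (\<Prod>a\<le>q. [:- (of_nat a / of_nat q), 1:])"

lemma node_poly_nonzero: "node_poly q \<noteq> 0"
  by (simp add: node_poly_def)

lemma degree_node_poly: "degree (node_poly q) = q + 1"
  unfolding node_poly_def by (subst degree_prod_eq_sum_degree) auto

lemma rpoly_node_poly:
  assumes "a \<le> q"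
  shows "rpoly (node_poly q) (of_rat (of_nat a / of_nat q)) = 0"
proof -
  have "poly (node_poly q) (of_nat a / of_nat q) = 0"
    using assms by (auto simp: node_poly_def poly_prod)
  then show ?thesis
    by (simp only: rpoly_of_rat) simp
qed

text \<open>Polynomials are images of coefficient lists, so there are countably many. Zero is left
  out so that the accumulated products remain nonzero.\<close>

lemma ex_enumeration_rat_polys:
  obtains m :: "nat \<Rightarrow> rat poly" where "\<And>k. m k \<noteq> 0" "\<And>p. p \<noteq> 0 \<Longrightarrow> \<exists>k. m k = p"
proof -
  have "countable (range (Poly :: rat list \<Rightarrow> rat poly))"
    by (intro countable_image countableI_type)
  moreover have "range (Poly :: rat list \<Rightarrow> rat poly) = UNIV"
    by (rule surjI[of _ coeffs]) simp
  ultimately have "countable (UNIV :: rat poly set)"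
    by (simp only:)
  then have countable: "countable (UNIV - {0 :: rat poly})"
    by (rule countable_Diff)
  show thesis
  proof (rule that)
    have "(1 :: rat poly) \<in> UNIV - {0}"
      by simp
    then have "from_nat_into (UNIV - {0 :: rat poly}) k \<in> UNIV - {0}" for k
      by (intro from_nat_into) blast
    then show "from_nat_into (UNIV - {0 :: rat poly}) k \<noteq> 0" for k
      by blast
    show "\<exists>k. from_nat_into (UNIV - {0}) k = p" if "p \<noteq> 0" for p :: "rat poly"
      using from_nat_into_surj[OF countable] that by blast
  qed
qed

lemma ex_small_multiple:
  fixes Q :: "rat poly"
  assumes "\<epsilon> > 0"
  obtains c :: rat where "c \<noteq> 0" "\<And>z. norm z \<le> R \<Longrightarrow> norm (rpoly (smult c Q) z) \<le> \<epsilon>"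
proof -
  have "compact (rpoly Q ` cball 0 R)"
    by (intro compact_continuous_image continuous_intros compact_cball)
  then obtain B where "\<forall>w\<in>rpoly Q ` cball 0 R. norm w \<le> B"
    using compact_imp_bounded bounded_iff by blast
  then have B: "norm (rpoly Q z) \<le> B" if "norm z \<le> R" for z
    using that by simp
  \<comment> \<open>\<open>\<bar>B\<bar> + 1\<close> is positive whatever the bound
    \<open>B\<close>, which may be zero, or negative if the disc is empty.\<close>
  have "\<epsilon> / (\<bar>B\<bar> + 1) > 0"
    using assms by (intro divide_pos_pos) auto
  then obtain c :: rat where c: "0 < (of_rat c :: real)" "of_rat c < \<epsilon> / (\<bar>B\<bar> + 1)"
    using of_rat_dense[of 0 "\<epsilon> / (\<bar>B\<bar> + 1)"] by auto
  show thesis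
  proof (rule that)
    show "c \<noteq> 0"
      using c by auto
    fix z :: complex assume "norm z \<le> R"
    then have "norm (rpoly Q z) \<le> \<bar>B\<bar> + 1"
      using B by fastforce
    then have "of_rat c * norm (rpoly Q z) \<le> \<epsilon> / (\<bar>B\<bar> + 1) * (\<bar>B\<bar> + 1)"
      using c assms by (intro mult_mono) auto
    also have "\<dots> = \<epsilon>"
      by simp
    also have "of_rat c = norm (of_rat c :: complex)"
    proof (cases c)
      case (Fract a b)
      then have "c = of_int a / of_int b"
        by (simp add: Fract_of_int_quotient)
      then show ?thesis
        using c(1) \<open>b > 0\<close> by (auto simp: of_rat_divide norm_divide zero_less_divide_iff)
    qed
    finally show "norm (rpoly (smult c Q) z) \<le> \<epsilon>"
      by (simp only: rpoly_simps norm_mult)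
  qed
qed

theorem mainTheorem1:
  fixes \<phi> :: "real \<Rightarrow> real"
  assumes "\<And>x. x \<ge> 0 \<Longrightarrow> \<phi> x \<ge> 0"
    and "((\<lambda>x. \<phi> x / x) \<longlongrightarrow> 0) at_top"
  shows "\<exists>f :: complex \<Rightarrow> complex. f holomorphic_on UNIV \<and> transcendental_fun f \<and>
    (\<forall>\<alpha>. algebraic \<alpha> \<longrightarrow> f \<alpha> \<in> adjoin_ring \<alpha>) \<and>
    (\<forall>D::nat. D \<ge> 1 \<longrightarrow>
      infinite {N::real. N \<ge> 0 \<and>
        real (card (Sigma_set D N f 1)) \<ge> 1 / 2 * exp (real D * (real D + 1) * \<phi> N)})"
proof -

  \<comment> \<open>Recursive choice of the partial sums\<close>
  obtain m :: "nat \<Rightarrow> rat poly" where m: "\<And>k. m k \<noteq> 0" "\<And>p. p \<noteq> 0 \<Longrightarrow> \<exists>k. m k = p"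
    by (rule ex_enumeration_rat_polys) blast
  note ex_q = ex_admissible[OF assms]

  \<comment> \<open>A state consists of the partial sum, the accumulated product and the number \<open>q\<^sub>k\<close>.\<close>
  define valid :: "nat \<Rightarrow> rat poly \<times> rat poly \<times> nat \<Rightarrow> bool" where
    "valid k = (\<lambda>(F, Q, q). Q \<noteq> 0 \<and> admissible \<phi> k F q \<and> (k = 0 \<longrightarrow> F = 0))" for k
  \<comment> \<open>\<open>c \<noteq> 0\<close> forces the degree to grow; smallness on the disc of
    radius \<open>k\<close> yields locally uniform convergence.\<close>
  define step :: "nat \<Rightarrow> rat poly \<times> rat poly \<times> nat \<Rightarrow> rat poly \<times> rat poly \<times> nat \<Rightarrow> bool" where
    "step k = (\<lambda>(F, Q, q) (F', Q', q'). Q' = Q * (m k * node_poly q) \<and>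
      (\<exists>c. c \<noteq> 0 \<and> F' = F + smult c Q' \<and>
        (\<forall>z. norm z \<le> real k \<longrightarrow> norm (rpoly (smult c Q') z) \<le> (1 / 2) ^ k)))" for k
  have "\<exists>s. \<forall>k. valid k (s k) \<and> step k (s k) (s (Suc k))"
  proof (rule dependent_nat_choice)
    obtain q where "admissible \<phi> 0 0 q"
      using ex_q by blast
    then have "valid 0 (0, 1, q)"
      by (simp add: valid_def)
    then show "\<exists>x. valid 0 x"
      by blast
  next
    fix x k assume x: "valid k x"
    obtain F Q q where x_eq: "x = (F, Q, q)"
      by (cases x)
    define Q' where "Q' = Q * (m k * node_poly q)"
    obtain c :: rat where c: "c \<noteq> 0"
        "\<And>z. norm z \<le> real k \<Longrightarrow> norm (rpoly (smult c Q') z) \<le> (1 / 2) ^ k"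
      using ex_small_multiple[of "(1 / 2) ^ k" "real k" Q'] by auto
    \<comment> \<open>The new \<open>q'\<close> comes last, since admissibility refers to the new
      partial sum.\<close>
    obtain q' where q': "admissible \<phi> (Suc k) (F + smult c Q') q'"
      using ex_q by blast
    have "Q' \<noteq> 0"
      using x m(1) node_poly_nonzero by (simp add: Q'_def x_eq valid_def)
    then have "valid (Suc k) (F + smult c Q', Q', q')"
      using q' by (simp add: valid_def)
    moreover have "step k x (F + smult c Q', Q', q')"
      unfolding step_def x_eq prod.case using c Q'_def by blast
    ultimately show "\<exists>y. valid (Suc k) y \<and> step k x y"
      by blast
  qed
  then obtain s where s: "\<And>k. valid k (s k)" "\<And>k. step k (s k) (s (Suc k))"
    by blast
  define F where "F k = fst (s k)" for k
  define Q where "Q k = fst (snd (s k))" for k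
  define q where "q k = snd (snd (s k))" for k
  have s_eq: "s k = (F k, Q k, q k)" for k
    by (simp add: F_def Q_def q_def)
  have Q_nz: "Q k \<noteq> 0" and good: "admissible \<phi> k (F k) (q k)" for k
    using s(1)[of k] by (auto simp: valid_def s_eq)
  have F_0: "F 0 = 0"
    using s(1)[of 0] by (auto simp: valid_def s_eq)
  have Q_Suc: "Q (Suc k) = Q k * (m k * node_poly (q k))" for k
    using s(2)[of k] by (auto simp: step_def s_eq)
  have "\<exists>c. c \<noteq> 0 \<and> F (Suc k) = F k + smult c (Q (Suc k)) \<and>
      (\<forall>z. norm z \<le> real k \<longrightarrow> norm (rpoly (smult c (Q (Suc k))) z) \<le> (1 / 2) ^ k)" for k
    using s(2)[of k] by (auto simp: step_def s_eq)
  then obtain c where c: "\<And>k. c k \<noteq> 0" "\<And>k. F (Suc k) = F k + smult (c k) (Q (Suc k))"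
      "\<And>k z. norm z \<le> real k \<Longrightarrow> norm (rpoly (smult (c k) (Q (Suc k))) z) \<le> (1 / 2) ^ k"
    by metis

  have Q_dvd: "Q j dvd Q k" if "j \<le> k" for j k
    using that by (induction rule: dec_induct) (auto simp: Q_Suc)
  \<comment> \<open>Once \<open>g\<close> divides one accumulated product it divides all later ones,
    so every further term vanishes at the roots of \<open>g\<close>.\<close>
  have stable: "rpoly (F k) z = rpoly (F j) z"
    if "g dvd Q (Suc j)" "rpoly g z = 0" "j \<le> k" for g j k z
    using that(3)
  proof (induction rule: dec_induct)
    case (step i)
    have "g dvd Q (Suc i)"
      using that(1) Q_dvd[of "Suc j" "Suc i"] step(1) dvd_trans by auto
    then obtain h where h: "Q (Suc i) = g * h"
      by (rule dvdE)
    have "rpoly (F (Suc i)) z = rpoly (F i) z"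
      unfolding c(2) h by (simp only: rpoly_simps that(2)) simp
    then show ?case
      using step by simp
  qed simp

  \<comment> \<open>The entire function and its values at algebraic numbers\<close>
  define f where "f z = (\<Sum>k. rpoly (smult (c k) (Q (Suc k))) z)" for z
  have F_sum: "rpoly (F n) z = (\<Sum>k<n. rpoly (smult (c k) (Q (Suc k))) z)" for n z
    by (induction n) (simp_all only: F_0 c(2) rpoly_simps(1) rpoly_simps(5) sum.lessThan_Suc lessThan_0 sum.empty)
  have lim: "uniform_limit (cball 0 R) (\<lambda>n. rpoly (F n)) f sequentially" for R
  proof -
    \<comment> \<open>On the disc of radius \<open>R\<close> the geometric bound holds only from
      index \<open>R\<close> on, hence the eventual form of the M-test.\<close>
    have ev: "\<forall>\<^sub>F k in sequentially. \<forall>z\<in>cball 0 R. norm (rpoly (smult (c k) (Q (Suc k))) z) \<le> (1 / 2) ^ k"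
      using eventually_ge_at_top[of "nat \<lceil>R\<rceil>"]
    proof eventually_elim
      case (elim k)
      then have "R \<le> real k"
        by linarith
      then show ?case
        using c(3) by auto
    qed
    have "uniform_limit (cball 0 R) (\<lambda>n z. \<Sum>k<n. rpoly (smult (c k) (Q (Suc k))) z) f sequentially"
      unfolding f_def by (rule Weierstrass_m_test_ev[OF ev]) (simp add: summable_geometric)
    then show ?thesis
      by (simp only: F_sum)
  qed
  have holo: "f holomorphic_on UNIV"
  proof (rule holomorphic_uniform_sequence[of UNIV "\<lambda>n. rpoly (F n)"])
    show "\<exists>d>0. cball z d \<subseteq> UNIV \<and> uniform_limit (cball z d) (\<lambda>n. rpoly (F n)) f sequentially" for z
    proof (intro exI[of _ 1] conjI)
      have "cball z 1 \<subseteq> cball 0 (norm z + 1)"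
        by (simp add: cball_subset_cball_iff)
      then show "uniform_limit (cball z 1) (\<lambda>n. rpoly (F n)) f sequentially"
        using lim uniform_limit_on_subset by blast
    qed auto
  qed (auto intro!: holomorphic_intros)
  have f_eq: "f z = rpoly (F j) z" if "g dvd Q (Suc j)" "rpoly g z = 0" for g j z
  proof -
    have "(\<lambda>n. rpoly (F n) z) \<longlonglongrightarrow> f z"
      by (rule tendsto_uniform_limitI[OF lim[of "norm z"]]) simp
    moreover have "\<forall>\<^sub>F n in sequentially. rpoly (F n) z = rpoly (F j) z"
      using eventually_ge_at_top[of j] by eventually_elim (rule stable[OF that])
    ultimately show ?thesis
      using LIMSEQ_unique[OF _ tendsto_eventually] by blast
  qed
  \<comment> \<open>The nodes for \<open>q k\<close> enter the product at index
    \<open>Suc k\<close>, so exactly the terms summed in \<open>F k\<close> may survive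
    there.\<close>
  have f_node: "f (of_rat (of_nat a / of_nat (q k))) = of_rat (poly (F k) (of_nat a / of_nat (q k)))"
    if "a \<le> q k" for a k
    unfolding rpoly_of_rat[symmetric] by (rule f_eq[OF _ rpoly_node_poly[OF that]]) (simp add: Q_Suc)
  have adjoin: "f \<alpha> \<in> adjoin_ring \<alpha>" if "algebraic \<alpha>" for \<alpha>
  proof -
    obtain p where p: "p \<noteq> 0" "poly (of_int_poly p) \<alpha> = 0"
      using \<open>algebraic \<alpha>\<close> by (rule algebraicE')
    \<comment> \<open>The integer polynomial vanishing at \<alpha> occurs in the enumeration and so
      divides \<open>Q (Suc k)\<close>.\<close>
    obtain k where k: "m k = of_int_poly p"
      using m(2)[of "of_int_poly p"] p by auto
    have "f \<alpha> = rpoly (F k) \<alpha>"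
      using p k by (intro f_eq[of "m k"]) (auto simp: Q_Suc rpoly_of_int_poly)
    then show ?thesis
      by (auto simp: adjoin_ring_iff)
  qed

  \<comment> \<open>Degree growth and transcendence\<close>
  have inj_nodes: "inj_on (\<lambda>a. of_rat (of_nat a / of_nat (q k)) :: complex) {..q k}" for k
    using good[of k] by (intro inj_onI) (auto simp: admissible_def)
  define nodes where "nodes k = (\<lambda>a. of_rat (of_nat a / of_nat (q k)) :: complex) ` {..q k}" for k
  have card_nodes: "card (nodes k) = q k + 1" for k
    unfolding nodes_def by (subst card_image[OF inj_nodes]) simp

  \<comment> \<open>The added term has degree at least \<open>q k + 1\<close>, which exceeds
    \<open>degree (F k)\<close>, so leading terms cannot cancel.\<close>
  have deg_less: "degree (F k) < degree (F (Suc k))" for k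
  proof -
    have "node_poly (q k) dvd Q (Suc k)"
      by (simp add: Q_Suc)
    then have "q k + 1 \<le> degree (smult (c k) (Q (Suc k)))"
      using dvd_imp_degree_le[of "node_poly (q k)"] Q_nz c(1) by (simp add: degree_node_poly)
    then have "degree (F k) < degree (smult (c k) (Q (Suc k)))"
      using good[of k] by (simp add: admissible_def)
    then show ?thesis
      using degree_add_eq_right[of "F k"] by (simp add: c(2))
  qed
  have transc: "transcendental_fun f"
    unfolding transcendental_fun_def
  proof safe
    fix P :: "complex poly poly"
    assume P: "P \<noteq> 0" "\<forall>z. poly (poly P [:f z:]) z = 0"
    define G where "G k = (map_poly of_rat (F k) :: complex poly)" for k
    obtain M where M: "\<And>H. degree (poly P H) \<le> M * (degree H + 1)"
      using degree_poly_const_le[of P] by blast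
    \<comment> \<open>The polynomial \<open>P (X, G k)\<close> has the \<open>q k + 1\<close> nodes
      as zeros, but degree at most \<open>M * (degree (F k) + 1)\<close>, which is at most
      \<open>q k\<close> for \<open>k \<ge> M\<close>.\<close>
    have root: "poly P (G k) = 0" if "k \<ge> M" for k
    proof (rule ccontr)
      assume nz: "poly P (G k) \<noteq> 0"
      have "nodes k \<subseteq> {z. poly (poly P (G k)) z = 0}"
      proof
        fix z assume "z \<in> nodes k"
        then have "f z = poly (G k) z"
          using f_node by (auto simp: nodes_def G_def rpoly_of_rat)
        then show "z \<in> {z. poly (poly P (G k)) z = 0}"
          using P(2) poly_poly_const[of P "G k" z] by (metis mem_Collect_eq)
      qed
      then have "card (nodes k) \<le> card {z. poly (poly P (G k)) z = 0}"
        using nz by (intro card_mono poly_roots_finite)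
      also have "\<dots> \<le> degree (poly P (G k))"
        by (rule card_poly_roots_bound[OF nz])
      also have "\<dots> \<le> M * (degree (F k) + 1)"
        using M[of "G k"] by (simp add: G_def)
      also have "\<dots> \<le> k * (degree (F k) + 1)"
        using that by (intro mult_right_mono) auto
      also have "\<dots> \<le> q k"
        using good[of k] by (simp add: admissible_def)
      finally show False
        by (simp add: card_nodes)
    qed
    have "strict_mono (\<lambda>k. degree (F k))"
      using deg_less by (rule strict_monoI_Suc)
    moreover have "degree (G k) = degree (F k)" for k
      by (simp add: G_def)
    ultimately have "inj G"
      by (metis injI strict_mono_eq)
    \<comment> \<open>The distinct degrees give infinitely many roots \<open>G k\<close> of
      \<open>P\<close>, viewed as a nonzero polynomial in \<open>Y\<close> over the integral domain
      \<open>\<complex>[X]\<close>.\<close>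
    then have "infinite (G ` {M..})"
      using finite_imageD inj_on_subset infinite_Ici by blast
    moreover have "G ` {M..} \<subseteq> {H. poly P H = 0}"
      using root by auto
    ultimately show False
      using poly_roots_finite[OF P(1)] finite_subset by blast
  qed

  \<comment> \<open>Counting points of bounded height\<close>
  have "infinite {N::real. N \<ge> 0 \<and>
      real (card (Sigma_set D N f 1)) \<ge> 1 / 2 * exp (real D * (real D + 1) * \<phi> N)}" (is "infinite ?S")
    if D: "D \<ge> 1" for D :: nat
  proof
    assume "finite ?S"
    then have "bdd_above ?S"
      by (rule bdd_above_finite)
    then obtain U where U: "\<And>N. N \<in> ?S \<Longrightarrow> N \<le> U"
      unfolding bdd_above_def by blast
    \<comment> \<open>\<open>k \<ge> D\<close> makes the growth condition available for this
      \<open>D\<close>; \<open>k > U\<close> makes the resulting \<open>N \<ge> k\<close> exceed the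
      supposed bound.\<close>
    define k where "k = max D (nat \<lceil>\<bar>U\<bar> + 1\<rceil>)"
    have k: "D \<le> k" "real k > U"
      unfolding k_def by linarith+
    obtain N where N: "N \<ge> real k"
        "\<And>a. a \<le> q k \<Longrightarrow> abs_log_height (of_rat (of_nat a / of_nat (q k))) \<le> N"
        "\<And>a. a \<le> q k \<Longrightarrow> abs_log_height (of_rat (poly (F k) (of_nat a / of_nat (q k)))) \<le> N"
        "exp (real D * (real D + 1) * \<phi> N) \<le> real (q k)"
      using good[of k] k(1) unfolding admissible_def by blast
    have "nodes k \<subseteq> Sigma_set D N f 1"
    proof
      fix z assume "z \<in> nodes k"
      then obtain a where a: "a \<le> q k" "z = of_rat (of_nat a / of_nat (q k))"
        by (auto simp: nodes_def)
      have q1: "q k \<ge> 1"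
        using good[of k] by (simp add: admissible_def)
      have fz: "f z = of_rat (poly (F k) (of_nat a / of_nat (q k)))"
        using f_node[OF a(1)] a(2) by simp
      have "norm z \<le> 1"
        using a q1 by (simp add: of_rat_divide norm_divide)
      moreover have "algebraic z" "algebraic (f z)"
        unfolding fz unfolding a(2) by (intro rat_imp_algebraic Rats_of_rat)+
      moreover have "degree_over_Q (adjoin_field {z, f z}) \<le> D"
        unfolding fz unfolding a(2) using degree_over_Q_rat D by (rule order_trans)
      moreover have "abs_log_height z \<le> N"
        unfolding a(2) by (rule N(2)[OF a(1)])
      moreover have "abs_log_height (f z) \<le> N"
        unfolding fz by (rule N(3)[OF a(1)])
      ultimately show "z \<in> Sigma_set D N f 1"
        by (simp add: Sigma_set_def)
    qed
    \<comment> \<open>Monotonicity of \<open>card\<close> rests on the finiteness of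
      \<open>Sigma_set\<close>, which follows from \<open>adjoin\<close> and Northcott.\<close>
    then have "q k + 1 \<le> card (Sigma_set D N f 1)"
      using card_mono[OF finite_Sigma_set[OF adjoin]] card_nodes by metis
    then have "exp (real D * (real D + 1) * \<phi> N) \<le> real (card (Sigma_set D N f 1))"
      using N(4) by linarith
    moreover have "1 / 2 * exp (real D * (real D + 1) * \<phi> N) \<le> exp (real D * (real D + 1) * \<phi> N)"
      by simp
    ultimately have "N \<in> ?S"
      using N(1) by (auto intro: order_trans)
    then show False
      using U N(1) k(2) by fastforce
  qed
  then show ?thesis
    using holo transc adjoin by blast
qed

end
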